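(* Let $h>0$ and $c>0$, and consider the discrete operator $D_h=ch^2\Delta_h^2-\Delta_{2h}$ on $G_h$. For the two-color Jacobi point relaxation applied to $D_h$, the optimal one-stage relaxation parameter $\omega_{opt}(c)$ and the related smoothing factor $\rho_{opt}(c)$ are as follows. (i) For $c\in(0,\frac18)\cup(\frac18,+\infty)$, writing $R(c)=82944c^4-6912c^3+336c^2+24c+1$ and $$N(c)=-1-36c+2736c^2+157248c^3-2115072c^4-2985984c^5+52199424c^6+R(c)\sqrt{R(c)},$$ one has $$\omega_{opt}(c)=\frac{3456(1-8c)^2c^2(20c+1)^2}{N(c)},$$ $$\rho_{opt}(c)=\frac{-1-36c+2736c^2-63936c^3+539136c^4-2985984c^5-4423680c^6+R(c)\sqrt{R(c)}}{N(c)}.$$ (ii) For $c=\frac18$, $$\omega_{opt}\left(\tfrac18\right)=\frac{98}{217},\qquad \rho_{opt}\left(\tfrac18\right)=\frac{25}{217}.$$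
   Context: Let $G_h=\{(k_1h,k_2h)\mid (k_1,k_2)\in\mathbb{Z}^2\}$ with mesh size $h>0$. The discrete operators have stencils $$\Delta_h^2=\frac{1}{h^4}\begin{bmatrix} & & 1 & & \\ & 2 & -8 & 2 & \\ 1 & -8 & 20 & -8 & 1\\ & 2 & -8 & 2 & \\ & & 1 & & \end{bmatrix}_h,\qquad -\Delta_{2h}=\frac{1}{4h^2}\begin{bmatrix}0&0&-1&0&0\\0&0&0&0&0\\-1&0&4&0&-1\\0&0&0&0&0\\0&0&-1&0&0\end{bmatrix}_h .$$ A scalar discrete operator $D_h=[l_{\vec{k}}]_h$ with stencil coefficients $l_{\vec{k}}\in\mathbb{R}$, $\vec{k}\in J\subset\mathbb{Z}^2$ ($J$ containing $(0,0)$), has Fourier symbol $\tilde{D}_h(\vec{\theta})=\sum_{\vec{k}\in J}l_{\vec{k}}\exp(i\vec{\theta}\cdot\vec{k})$ for $\vec{\theta}\in(-\pi,\pi]^2$. For $D_h=ch^2\Delta_h^2-\Delta_{2h}$ this gives $$\tilde{D}_h(\vec{\theta})=\frac{1}{h^2}\left[4c(2-\cos\theta_1-\cos\theta_2)^2+\sin^2\theta_1+\sin^2\theta_2\right].$$ Let $\tilde{D}_h^0(\vec{\theta})=l_{(0,0)}$ be the Fourier symbol of the discrete operator with stencil $[l_{(0,0)}]_h$, i.e. of the diagonal part of $D_h$ (here $l_{(0,0)}=(1+20c)/h^2$). Let $\Theta_{low}=(-\frac{\pi}{2},\frac{\pi}{2}]^2$. For $\vec{\theta}\in\Theta_{low}$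 and $\alpha\in\{0,1\}$ put $\vec{\theta}^\alpha=(\vec{\theta}+(\alpha,\alpha)\pi)\bmod 2\pi$ (components in $(-\pi,\pi]$) and $A_\alpha=1-\tilde{D}_h(\vec{\theta}^\alpha)/\tilde{D}_h^0(\vec{\theta}^\alpha)$, the symbol of Jacobi point relaxation. The two-color Jacobi point relaxation splits $G_h$ into the points with $k_1+k_2$ even and those with $k_1+k_2$ odd, and sweeps first the former and then the latter by Jacobi point relaxation. Its Fourier representation for $D_h$ with relaxation parameter $\omega=1$, on the span of the Fourier modes $\exp(i\vec{\theta}^\alpha\cdot\vec{x}/h)$, $\alpha=0,1$, is $$\widehat{S}_h^{01}(\vec{\theta},1)=\frac12\begin{pmatrix}A_0+1 & -A_1+1\\ -A_0+1 & A_1+1\end{pmatrix}\cdot\frac12\begin{pmatrix}A_0+1 & A_1-1\\ A_0-1 & A_1+1\end{pmatrix}.$$ The ideal coarse-grid correction (which drops the low-frequency modes and keeps the high-frequency ones) has the representation $\widehat{Q}_h^{2h}=\mathrm{diag}(0,1)$. Let $S_{\max},S_{\min}\in(-1,1)$ be the maximum and minimum, over $\vec{\theta}\in\Theta_{low}$, of the eigenvalues of $\widehat{Q}_h^{2h}\widehat{S}_h^{01}(\vec{\theta},1)$. The optimal one-stage relaxation parameter and the related smoothing factor are given by $$\omega_{opt}=\frac{2}{2-S_{\max}-S_{\min}},\qquad \rho_{opt}=\frac{S_{\max}-S_{\min}}{2-S_{\max}-S_{\min}}.$$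
   Formalization: In (ii) the value of ω_opt(1/8) is proved to be 196/217 instead of the printed 98/217, which is false: at c=1/8, S_max=1/49 and S_min=-23/98, so 2-S_max-S_min=217/98. *)

theory Defs
  imports Complex_Main "Jordan_Normal_Form.Char_Poly"
begin

section \<open>Stencils and Fourier symbols\<close>

text \<open>A scalar discrete operator on the grid of mesh size \<open>h\<close> is given by its stencil, a finitely
  supported function on \<open>\<int>\<^sup>2\<close>. Grid points \<open>(k\<^sub>1 h, k\<^sub>2 h)\<close> are identified with their
  index \<open>(k\<^sub>1, k\<^sub>2)\<close>.\<close>

type_synonym stencil = "int \<times> int \<Rightarrow> real"

text \<open>Rows are listed from top (\<open>k\<^sub>2 = 2\<close>) to bottom (\<open>k\<^sub>2 = -2\<close>), and within a row from left
  (\<open>k\<^sub>1 = -2\<close>) to right (\<open>k\<^sub>1 = 2\<close>), as a stencil is usually displayed.\<close>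

definition stencil5 :: "real list list \<Rightarrow> stencil" where
  "stencil5 M = (\<lambda>(k1, k2).
     if \<bar>k1\<bar> \<le> 2 \<and> \<bar>k2\<bar> \<le> 2 then M ! nat (2 - k2) ! nat (k1 + 2) else 0)"

definition biharmonic :: "real \<Rightarrow> stencil" where
  "biharmonic h k = 1 / h ^ 4 * stencil5
     [[0,  0,  1,  0, 0],
      [0,  2, -8,  2, 0],
      [1, -8, 20, -8, 1],
      [0,  2, -8,  2, 0],
      [0,  0,  1,  0, 0]] k"

definition neg_laplace_2h :: "real \<Rightarrow> stencil" where
  "neg_laplace_2h h k = 1 / (4 * h ^ 2) * stencil5
     [[ 0, 0, -1, 0,  0],
      [ 0, 0,  0, 0,  0],
      [-1, 0,  4, 0, -1],
      [ 0, 0,  0, 0,  0],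
      [ 0, 0, -1, 0,  0]] k"

definition D_op :: "real \<Rightarrow> real \<Rightarrow> stencil" where
  "D_op h c k = c * h ^ 2 * biharmonic h k + neg_laplace_2h h k"

definition mode :: "real \<times> real \<Rightarrow> int \<times> int \<Rightarrow> complex" where
  "mode \<theta> k = exp (\<i> * of_real (fst \<theta> * of_int (fst k) + snd \<theta> * of_int (snd k)))"

definition symbol :: "stencil \<Rightarrow> real \<times> real \<Rightarrow> complex" where
  "symbol l \<theta> = (\<Sum>k | l k \<noteq> 0. of_real (l k) * mode \<theta> k)"

definition diag_part :: "stencil \<Rightarrow> stencil" where
  "diag_part l k = (if k = (0, 0) then l (0, 0) else 0)"


section \<open>Two-color Jacobi point relaxation in Fourier space\<close>

definition \<Theta>_low :: "(real \<times> real) set" where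
  "\<Theta>_low = {- (pi/2) <.. pi/2} \<times> {- (pi/2) <.. pi/2}"

text \<open>The representative modulo \<open>2\<pi>\<close> in \<open>(-\<pi>, \<pi>]\<close>.\<close>

definition wrap :: "real \<Rightarrow> real" where
  "wrap x = x - 2 * pi * of_int \<lceil>(x - pi) / (2 * pi)\<rceil>"

definition shift :: "nat \<Rightarrow> real \<times> real \<Rightarrow> real \<times> real" where
  "shift \<alpha> \<theta> = (wrap (fst \<theta> + real \<alpha> * pi), wrap (snd \<theta> + real \<alpha> * pi))"

definition jacobi_symbol :: "stencil \<Rightarrow> real \<times> real \<Rightarrow> nat \<Rightarrow> complex" where
  "jacobi_symbol l \<theta> \<alpha> =
     1 - symbol l (shift \<alpha> \<theta>) / symbol (diag_part l) (shift \<alpha> \<theta>)"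

definition two_color_jacobi_rep :: "stencil \<Rightarrow> real \<times> real \<Rightarrow> complex mat" where
  "two_color_jacobi_rep l \<theta> =
    (let A0 = jacobi_symbol l \<theta> 0; A1 = jacobi_symbol l \<theta> 1 in
       ((1/2) \<cdot>\<^sub>m mat_of_rows_list 2 [[A0 + 1, - A1 + 1], [- A0 + 1, A1 + 1]]) *
       ((1/2) \<cdot>\<^sub>m mat_of_rows_list 2 [[A0 + 1, A1 - 1], [A0 - 1, A1 + 1]]))"

definition ideal_cgc :: "complex mat" where
  "ideal_cgc = mat_of_rows_list 2 [[0, 0], [0, 1]]"


section \<open>Optimal one-stage relaxation parameter and smoothing factor\<close>

definition smoothing_eigenvalues :: "stencil \<Rightarrow> complex set" where
  "smoothing_eigenvalues l =
     {z. \<exists>\<theta>\<in>\<Theta>_low. eigenvalue (ideal_cgc * two_color_jacobi_rep l \<theta>) z}"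

text \<open>Symbols are complex a priori, so that the eigenvalues are real is part of the claim that a
  real maximum (minimum) exists.\<close>

definition is_maximum :: "complex set \<Rightarrow> real \<Rightarrow> bool" where
  "is_maximum E s \<longleftrightarrow> complex_of_real s \<in> E \<and> (\<forall>z\<in>E. z \<in> \<real> \<and> Re z \<le> s)"

definition is_minimum :: "complex set \<Rightarrow> real \<Rightarrow> bool" where
  "is_minimum E s \<longleftrightarrow> complex_of_real s \<in> E \<and> (\<forall>z\<in>E. z \<in> \<real> \<and> s \<le> Re z)"

definition S_max :: "stencil \<Rightarrow> real" where
  "S_max l = (THE s. is_maximum (smoothing_eigenvalues l) s)"

definition S_min :: "stencil \<Rightarrow> real" where
  "S_min l = (THE s. is_minimum (smoothing_eigenvalues l) s)"

definition omega_opt :: "stencil \<Rightarrow> real" where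
  "omega_opt l = 2 / (2 - S_max l - S_min l)"

definition rho_opt :: "stencil \<Rightarrow> real" where
  "rho_opt l = (S_max l - S_min l) / (2 - S_max l - S_min l)"


section \<open>Consistency of the definitions\<close>

lemma wrap_range: "wrap x \<in> {- pi <.. pi}"
proof -
  define y where "y = (x - pi) / (2 * pi)"
  have x: "x = 2 * pi * y + pi" by (simp add: y_def)
  have "of_int \<lceil>y\<rceil> - 1 < y" "y \<le> of_int \<lceil>y\<rceil>" by linarith+
  then have "2 * pi * (of_int \<lceil>y\<rceil> - 1) < 2 * pi * y" "2 * pi * y \<le> 2 * pi * of_int \<lceil>y\<rceil>"
    by (auto intro: mult_strict_left_mono mult_left_mono)
  then show ?thesis by (auto simp: wrap_def y_def[symmetric] x algebra_simps)
qed

lemma is_maximum_unique: "is_maximum E s \<Longrightarrow> is_maximum E t \<Longrightarrow> s = t"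
  by (force simp: is_maximum_def intro: antisym)

lemma is_minimum_unique: "is_minimum E s \<Longrightarrow> is_minimum E t \<Longrightarrow> s = t"
  by (force simp: is_minimum_def intro: antisym)

lemma symbol_diag_part: "symbol (diag_part l) \<theta> = of_real (l (0, 0))"
proof (cases "l (0, 0) = 0")
  case True
  then have "{k. diag_part l k \<noteq> 0} = {}" by (auto simp: diag_part_def)
  then show ?thesis unfolding symbol_def by (simp only: True sum.empty of_real_0)
next
  case False
  then have "{k. diag_part l k \<noteq> 0} = {(0, 0)}" by (auto simp: diag_part_def)
  then show ?thesis by (simp add: symbol_def diag_part_def mode_def)
qed

lemma D_op_diag: "h > 0 \<Longrightarrow> D_op h c (0, 0) = (1 + 20 * c) / h ^ 2"
  by (simp add: D_op_def biharmonic_def neg_laplace_2h_def stencil5_def field_simps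
      eval_nat_numeral)

lemma mode_cis: "mode \<theta> k = cis (fst \<theta> * of_int (fst k) + snd \<theta> * of_int (snd k))"
  by (simp add: mode_def cis_conv_exp)

lemma symbol_D_op:
  assumes "h > 0"
  shows "symbol (D_op h c) (\<theta>1, \<theta>2) = of_real
    ((4 * c * (2 - cos \<theta>1 - cos \<theta>2)\<^sup>2 + (sin \<theta>1)\<^sup>2 + (sin \<theta>2)\<^sup>2) / h\<^sup>2)"
proof -
  have range: "{-2..2} = {-2, -1, 0, 1, 2::int}" by auto
  have D: "D_op h c k = (c * stencil5
     [[0,  0,  1,  0, 0],
      [0,  2, -8,  2, 0],
      [1, -8, 20, -8, 1],
      [0,  2, -8,  2, 0],
      [0,  0,  1,  0, 0]] k + stencil5
     [[ 0, 0, -1, 0,  0],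
      [ 0, 0,  0, 0,  0],
      [-1, 0,  4, 0, -1],
      [ 0, 0,  0, 0,  0],
      [ 0, 0, -1, 0,  0]] k / 4) / h\<^sup>2" for k
    using assms by (simp add: D_op_def biharmonic_def neg_laplace_2h_def field_simps eval_nat_numeral)
  have "symbol (D_op h c) (\<theta>1, \<theta>2) =
      (\<Sum>k\<in>{-2..2} \<times> {-2..2}. of_real (D_op h c k) * mode (\<theta>1, \<theta>2) k)"
    unfolding symbol_def
    by (rule sum.mono_neutral_left)
      (auto simp: D_op_def biharmonic_def neg_laplace_2h_def stencil5_def split: if_splits)
  also have "\<dots> = (\<Sum>k1\<in>{-2..2}. \<Sum>k2\<in>{-2..2}. of_real (D_op h c (k1, k2)) * mode (\<theta>1, \<theta>2) (k1, k2))"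
    by (simp add: sum.cartesian_product)
  also have "\<dots> = of_real ((c * (20 - 16 * cos \<theta>1 - 16 * cos \<theta>2 + 4 * (cos (\<theta>1 + \<theta>2) + cos (\<theta>1 - \<theta>2))
        + 2 * cos (2 * \<theta>1) + 2 * cos (2 * \<theta>2))
      + (4 - 2 * cos (2 * \<theta>1) - 2 * cos (2 * \<theta>2)) / 4) / h\<^sup>2)"
    unfolding range D using assms
    by (simp add: stencil5_def mode_cis complex_eq_iff mult.commute[of _ 2])
      (simp add: cos_add cos_diff sin_add sin_diff diff_divide_distrib add_divide_distrib algebra_simps)
  also have "c * (20 - 16 * cos \<theta>1 - 16 * cos \<theta>2 + 4 * (cos (\<theta>1 + \<theta>2) + cos (\<theta>1 - \<theta>2))
        + 2 * cos (2 * \<theta>1) + 2 * cos (2 * \<theta>2))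
      + (4 - 2 * cos (2 * \<theta>1) - 2 * cos (2 * \<theta>2)) / 4
    = 4 * c * (2 - cos \<theta>1 - cos \<theta>2)\<^sup>2 + (sin \<theta>1)\<^sup>2 + (sin \<theta>2)\<^sup>2"
    by (simp add: cos_add cos_diff cos_double_cos sin_squared_eq)
      (simp add: field_simps power2_eq_square)
  finally show ?thesis .
qed

text \<open>The matrix \<^const>\<open>two_color_jacobi_rep\<close> represents the two-color sweep: Jacobi point
  relaxation (acting on the error, \<open>\<omega> = 1\<close>) is applied first at the points with \<open>k\<^sub>1 + k\<^sub>2\<close> even, then at
  those with \<open>k\<^sub>1 + k\<^sub>2\<close> odd.\<close>

definition jacobi_sweep ::
  "stencil \<Rightarrow> (int \<times> int) set \<Rightarrow> (int \<times> int \<Rightarrow> complex) \<Rightarrow> int \<times> int \<Rightarrow> complex" where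
  "jacobi_sweep l C u k =
     (if k \<in> C
      then u k - (\<Sum>j | l j \<noteq> 0. of_real (l j) * u (fst k + fst j, snd k + snd j)) / of_real (l (0, 0))
      else u k)"

definition two_color_jacobi ::
  "stencil \<Rightarrow> (int \<times> int \<Rightarrow> complex) \<Rightarrow> int \<times> int \<Rightarrow> complex" where
  "two_color_jacobi l u =
     jacobi_sweep l {k. odd (fst k + snd k)} (jacobi_sweep l {k. even (fst k + snd k)} u)"

lemma mode_add: "mode \<theta> (fst k + fst j, snd k + snd j) = mode \<theta> k * mode \<theta> j"
  by (simp add: mode_def exp_add[symmetric] algebra_simps)

lemma mode_wrap: "mode (wrap x, wrap y) k = mode (x, y) k"
proof -
  define m n where "m = \<lceil>(x - pi) / (2 * pi)\<rceil>" and "n = \<lceil>(y - pi) / (2 * pi)\<rceil>"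
  have "mode (wrap x, wrap y) k = cis (x * of_int (fst k) + y * of_int (snd k)
      + 2 * pi * of_int (- (m * fst k + n * snd k)))"
    unfolding mode_cis
    by (rule arg_cong[of _ _ cis]) (simp add: wrap_def flip: m_def n_def, simp add: algebra_simps)
  also have "\<dots> = mode (x, y) k"
    unfolding cis_mult[symmetric] mode_cis by (subst cis_multiple_2pi) auto
  finally show ?thesis .
qed

lemma mode_shift_1:
  "mode (shift 1 \<theta>) k = (if even (fst k + snd k) then 1 else - 1) * mode (shift 0 \<theta>) k"
proof -
  have *: "cis (pi * of_int n) = (if even n then 1 else - 1)" for n
    by (simp add: cis.ctr complex_eq_iff)
  have "mode (shift 1 \<theta>) k = cis (pi * of_int (fst k + snd k)) * mode (shift 0 \<theta>) k"
    unfolding shift_def mode_wrap by (simp add: mode_cis cis_mult algebra_simps)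
  then show ?thesis unfolding * .
qed

lemma jacobi_sweep_mode:
  fixes a0 a1 :: complex
  shows
  "jacobi_sweep l C (\<lambda>k. a0 * mode (shift 0 \<theta>) k + a1 * mode (shift 1 \<theta>) k) k =
   (if k \<in> C then a0 * jacobi_symbol l \<theta> 0 * mode (shift 0 \<theta>) k + a1 * jacobi_symbol l \<theta> 1 * mode (shift 1 \<theta>) k
     else a0 * mode (shift 0 \<theta>) k + a1 * mode (shift 1 \<theta>) k)"
proof -
  have "(\<Sum>j | l j \<noteq> 0. of_real (l j) * (a0 * mode (shift 0 \<theta>) (fst k + fst j, snd k + snd j)
        + a1 * mode (shift 1 \<theta>) (fst k + fst j, snd k + snd j)))
    = a0 * symbol l (shift 0 \<theta>) * mode (shift 0 \<theta>) k + a1 * symbol l (shift 1 \<theta>) * mode (shift 1 \<theta>) k"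
    unfolding symbol_def mode_add sum_distrib_left sum_distrib_right sum.distrib[symmetric]
    by (rule sum.cong) (simp_all add: algebra_simps)
  then show ?thesis
    by (simp add: jacobi_sweep_def jacobi_symbol_def symbol_diag_part
      algebra_simps diff_divide_distrib add_divide_distrib)
qed

lemma two_color_jacobi_rep_correct:
  assumes a: "a \<in> carrier_vec 2"
    and b: "b = two_color_jacobi_rep l \<theta> *\<^sub>v a"
  shows "two_color_jacobi l (\<lambda>k. a $ 0 * mode (shift 0 \<theta>) k + a $ 1 * mode (shift 1 \<theta>) k) =
    (\<lambda>k. b $ 0 * mode (shift 0 \<theta>) k + b $ 1 * mode (shift 1 \<theta>) k)"
proof
  fix k :: "int \<times> int"
  define A0 A1 where "A0 = jacobi_symbol l \<theta> 0" and "A1 = jacobi_symbol l \<theta> 1"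
  define a0 a1 where "a0 = a $ 0" and "a1 = a $ 1"
  have mult: "(M *\<^sub>v v) $ i = M $$ (i, 0) * v $ 0 + M $$ (i, 1) * v $ 1"
    if "M \<in> carrier_mat 2 2" "v \<in> carrier_vec 2" "i < 2" for M :: "complex mat" and v i
    using that by (auto simp: scalar_prod_def numeral_2_eq_2)
  define P where "P = (1/2) \<cdot>\<^sub>m mat_of_rows_list 2 [[A0 + 1, - A1 + 1], [- A0 + 1, A1 + 1]]"
  define Q where "Q = (1/2) \<cdot>\<^sub>m mat_of_rows_list 2 [[A0 + 1, A1 - 1], [A0 - 1, A1 + 1]]"
  have PQ: "P \<in> carrier_mat 2 2" "Q \<in> carrier_mat 2 2"
    by (auto simp: P_def Q_def mat_of_rows_list_def)
  define w where "w = Q *\<^sub>v a"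
  have w: "w \<in> carrier_vec 2" using PQ a by (simp add: w_def)
  have bP: "b = P *\<^sub>v w"
    using PQ a by (simp add: b two_color_jacobi_rep_def A0_def A1_def P_def Q_def w_def Let_def)
  have entries: "P $$ (0, 0) = (A0 + 1) / 2" "P $$ (0, 1) = (1 - A1) / 2"
      "P $$ (1, 0) = (1 - A0) / 2" "P $$ (1, 1) = (A1 + 1) / 2"
      "Q $$ (0, 0) = (A0 + 1) / 2" "Q $$ (0, 1) = (A1 - 1) / 2"
      "Q $$ (1, 0) = (A0 - 1) / 2" "Q $$ (1, 1) = (A1 + 1) / 2"
    by (simp_all add: P_def Q_def mat_of_rows_list_def)
  have b01: "b $ 0 = ((A0 + 1) * w $ 0 + (1 - A1) * w $ 1) / 2"
      "b $ 1 = ((1 - A0) * w $ 0 + (A1 + 1) * w $ 1) / 2"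
    by (simp_all add: bP mult[OF PQ(1) w] entries add_divide_distrib diff_divide_distrib
        algebra_simps del: One_nat_def)
  have w01: "w $ 0 = ((A0 + 1) * a0 + (A1 - 1) * a1) / 2"
      "w $ 1 = ((A0 - 1) * a0 + (A1 + 1) * a1) / 2"
    by (simp_all add: w_def a0_def a1_def mult[OF PQ(2) a] entries add_divide_distrib
        diff_divide_distrib algebra_simps del: One_nat_def)
  have first: "jacobi_sweep l {k. even (fst k + snd k)}
      (\<lambda>k. a0 * mode (shift 0 \<theta>) k + a1 * mode (shift 1 \<theta>) k)
    = (\<lambda>k. w $ 0 * mode (shift 0 \<theta>) k + w $ 1 * mode (shift 1 \<theta>) k)"
    by (rule ext, unfold jacobi_sweep_mode, unfold mode_shift_1 A0_def[symmetric] A1_def[symmetric] w01)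
      (auto simp: field_simps)
  have second: "jacobi_sweep l {k. odd (fst k + snd k)}
      (\<lambda>k. w $ 0 * mode (shift 0 \<theta>) k + w $ 1 * mode (shift 1 \<theta>) k) k
    = b $ 0 * mode (shift 0 \<theta>) k + b $ 1 * mode (shift 1 \<theta>) k"
    by (unfold jacobi_sweep_mode, unfold mode_shift_1 A0_def[symmetric] A1_def[symmetric] b01)
      (auto simp: field_simps)
  show "two_color_jacobi l (\<lambda>k. a $ 0 * mode (shift 0 \<theta>) k + a $ 1 * mode (shift 1 \<theta>) k) k =
      b $ 0 * mode (shift 0 \<theta>) k + b $ 1 * mode (shift 1 \<theta>) k"
    unfolding two_color_jacobi_def first[unfolded a0_def a1_def] second ..
qed

end

theory Submission
  imports Defs
begin

text \<open>After the ideal coarse-grid correction only the lower row of the smoother's matrix survives, so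
  the eigenvalues are \<open>0\<close> and the lower right entry. With \<open>x\<close>, \<open>y\<close> the cosines of the two frequencies,
  which sweep the whole unit square, that entry is the real number \<open>1 - G(x, y) / (1 + 20 c)\<^sup>2\<close>, where
  \<open>G\<close> (\<open>contraction_defect\<close>) is a cubic polynomial depending only on \<open>s = x + y\<close> and
  \<open>x\<^sup>2 + y\<^sup>2\<close>. The extreme eigenvalues are therefore governed by the extrema of \<open>G\<close> on the square.

  The minimum of \<open>G\<close> lies at the corner \<open>x = y = 1\<close> (the lemma \<open>contraction_defect_ge\<close>): the excess over
  the corner value splits into manifestly nonnegative terms.

  For the maximum, fixing \<open>s\<close> makes \<open>G\<close> decreasing in \<open>x\<^sup>2 + y\<^sup>2\<close>, so the diagonal \<open>x = y = s / 2\<close> is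
  best. On it \<open>G\<close> is a cubic \<open>g(s)\<close> whose derivative
  \<open>192 c\<^sup>2 - (96 c\<^sup>2 + 12 c + 1) s - 12 c (8 c - 1) s\<^sup>2\<close> has one zero in \<open>[0, 2]\<close>. The
  discriminant of this quadratic is the polynomial \<open>R\<close> of the theorem, which is where \<open>sqrt R\<close> comes
  from. That the zero is the global maximum on \<open>[0, 2]\<close> follows by factoring the square of the
  distance to it out of the difference of the two values (\<open>contraction_defect_diagonal_le\<close>).

  The maximum of \<open>G\<close> is at least \<open>(1 + 20 c)\<^sup>2\<close> and the minimum is at most that, so the eigenvalue \<open>0\<close>
  lies between the two extremes. With \<open>m\<close> and \<open>M\<close> the minimum and maximum of \<open>G\<close>, the parameters
  are \<open>2 (1 + 20 c)\<^sup>2 / (m + M)\<close> and \<open>(M - m) / (m + M)\<close>; clearing the denominator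
  \<open>24 c (8 c - 1)\<close> of the critical point turns these into the stated closed forms. At \<open>c = 1/8\<close> that
  denominator vanishes since \<open>g\<close> degenerates to a quadratic, which is why this value stands apart.\<close>

section \<open>The smoothing eigenvalues as a real function of the cosines\<close>

lemma cos_wrap: "cos (wrap x) = cos x"
  and sin_wrap: "sin (wrap x) = sin x"
proof -
  have "cis (wrap x) = cis x"
    using mode_wrap[of x 0 "(1, 0)"] by (simp add: mode_cis)
  then show "cos (wrap x) = cos x" "sin (wrap x) = sin x"
    by (auto simp: complex_eq_iff)
qed

lemma eigenvalue_zero_first_row:
  fixes M :: "complex mat"
  assumes M: "M \<in> carrier_mat 2 2" and row: "M $$ (0, 0) = 0" "M $$ (0, 1) = 0"
  shows "eigenvalue M z \<longleftrightarrow> z = 0 \<or> z = M $$ (1, 1)"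
proof -
  have "det (char_matrix M z) = - z * (M $$ (1, 1) - z)"
  proof (subst det_lower_triangular)
    show "char_matrix M z \<in> carrier_mat 2 2" using M by simp
    show "char_matrix M z $$ (i, j) = 0" if "i < j" "j < 2" for i j
    proof -
      have "i = 0" "j = 1" using that by auto
      then show ?thesis using M row by (simp add: char_matrix_def)
    qed
    show "prod_list (diag_mat (char_matrix M z)) = - z * (M $$ (1, 1) - z)"
      using M row by (simp add: char_matrix_def diag_mat_def numeral_2_eq_2)
  qed
  then show ?thesis by (auto simp: eigenvalue_det[OF M])
qed

lemma entries_cgc_mult_two_color_jacobi:
  fixes l \<theta>
  defines "M \<equiv> ideal_cgc * two_color_jacobi_rep l \<theta>"
    and "B0 \<equiv> 1 - jacobi_symbol l \<theta> 0" and "B1 \<equiv> 1 - jacobi_symbol l \<theta> 1"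
  shows "M \<in> carrier_mat 2 2" "M $$ (0, 0) = 0" "M $$ (0, 1) = 0"
    "M $$ (1, 1) = 1 - B1 + B1 * (B1 - B0) / 4"
proof -
  show "M \<in> carrier_mat 2 2"
    by (auto simp: M_def ideal_cgc_def two_color_jacobi_rep_def mat_of_rows_list_def Let_def)
  show "M $$ (0, 0) = 0" "M $$ (0, 1) = 0"
      "M $$ (1, 1) = 1 - B1 + B1 * (B1 - B0) / 4"
    by (simp_all add: M_def B0_def B1_def ideal_cgc_def two_color_jacobi_rep_def
        mat_of_rows_list_def Let_def scalar_prod_def numeral_2_eq_2 field_simps)
qed

text \<open>With \<open>A\<^sub>1 = 1 - B\<^sub>1\<close> and \<open>A\<^sub>0 = 1 - B\<^sub>0\<close> the remaining eigenvalue is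
  \<open>1 - B\<^sub>1 + B\<^sub>1 (B\<^sub>1 - B\<^sub>0) / 4\<close>. The high-frequency symbol gives the first factor below, and
  in \<open>B\<^sub>1 - B\<^sub>0\<close> everything but the cross term \<open>32 c (x + y)\<close> cancels, which gives the second one. The
  common denominator \<open>(1 + 20 c)\<^sup>2\<close> is left out to keep a polynomial.\<close>

definition contraction_defect :: "real \<Rightarrow> real \<Rightarrow> real \<Rightarrow> real" where
  "contraction_defect c x y =
     (4 * c * (2 + x + y)\<^sup>2 + 2 - x\<^sup>2 - y\<^sup>2) * (1 + 20 * c - 8 * c * (x + y))"

lemma eigenvalue_D_op:
  assumes "h > 0" "c > 0"
  shows "eigenvalue (ideal_cgc * two_color_jacobi_rep (D_op h c) \<theta>) z \<longleftrightarrow>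
    z = 0 \<or> z = of_real (1 - contraction_defect c (cos (fst \<theta>)) (cos (snd \<theta>)) / (1 + 20 * c)\<^sup>2)"
proof -
  define x y L where "x = cos (fst \<theta>)" and "y = cos (snd \<theta>)" and "L = 1 + 20 * c"
  have L: "L > 0" using assms by (simp add: L_def)
  have B0: "1 - jacobi_symbol (D_op h c) \<theta> 0 =
      of_real ((4 * c * (2 - x - y)\<^sup>2 + 2 - x\<^sup>2 - y\<^sup>2) / L)"
    using assms(1)
    by (simp add: jacobi_symbol_def shift_def symbol_diag_part symbol_D_op D_op_diag cos_wrap sin_wrap
        sin_squared_eq x_def y_def L_def)
  have B1: "1 - jacobi_symbol (D_op h c) \<theta> 1 =
      of_real ((4 * c * (2 + x + y)\<^sup>2 + 2 - x\<^sup>2 - y\<^sup>2) / L)"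
    using assms(1)
    by (simp add: jacobi_symbol_def shift_def symbol_diag_part symbol_D_op D_op_diag cos_wrap sin_wrap
        sin_squared_eq x_def y_def L_def)
  define P Q where "P = 4 * c * (2 + x + y)\<^sup>2 + 2 - x\<^sup>2 - y\<^sup>2"
    and "Q = 4 * c * (2 - x - y)\<^sup>2 + 2 - x\<^sup>2 - y\<^sup>2"
  have PQ: "P - Q = 32 * c * (x + y)"
    by (simp add: P_def Q_def power2_eq_square algebra_simps)
  have "1 - P / L + P / L * (P / L - Q / L) / 4 = 1 - P / L + P * (P - Q) / (4 * L\<^sup>2)"
    using L by (simp add: field_simps power2_eq_square)
  also have "\<dots> = 1 - P * (L - 8 * c * (x + y)) / L\<^sup>2"
    unfolding PQ using L by (simp add: field_simps power2_eq_square)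
  finally have "1 - P / L + P / L * (P / L - Q / L) / 4 = 1 - contraction_defect c x y / L\<^sup>2"
    by (simp add: contraction_defect_def P_def L_def)
  then have "of_real (1 - P / L + P / L * (P / L - Q / L) / 4) =
      (of_real (1 - contraction_defect c x y / L\<^sup>2) :: complex)"
    by (rule arg_cong)
  then show ?thesis
    unfolding eigenvalue_zero_first_row[OF entries_cgc_mult_two_color_jacobi(1-3)]
      entries_cgc_mult_two_color_jacobi(4) B0 B1 P_def[symmetric] Q_def[symmetric]
      x_def[symmetric] y_def[symmetric] L_def[symmetric]
    by (simp only: of_real_add of_real_diff of_real_mult of_real_divide of_real_1 of_real_numeral)
qed

text \<open>The cosine already covers \<open>[0, 1]\<close> on the half \<open>[0, \<pi>/2]\<close> of the frequency interval, so the open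
  left end is harmless and all extrema are attained.\<close>

lemma cos_range_\<Theta>_low:
  "(\<lambda>\<theta>. (cos (fst \<theta>), cos (snd \<theta>))) ` \<Theta>_low = {0..1} \<times> {0..1}"
proof -
  have "cos ` {- (pi/2) <.. pi/2} = {0..1}"
  proof (intro equalityI subsetI)
    fix t :: real assume t: "t \<in> {0..1}"
    then have "arccos t \<in> {- (pi/2) <.. pi/2}"
      using arccos_lbound[of t] arccos_le_pi2[of t] pi_gt_zero
      by (auto intro: less_le_trans[of _ 0])
    moreover have "t = cos (arccos t)" using t by simp
    ultimately show "t \<in> cos ` {- (pi/2) <.. pi/2}" by blast
  qed (auto intro: cos_ge_zero)
  moreover have "(\<lambda>\<theta>::real \<times> real. (cos (fst \<theta>), cos (snd \<theta>))) = map_prod cos cos"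
    by auto
  ultimately show ?thesis
    unfolding \<Theta>_low_def by (simp only: map_prod_surj_on)
qed

lemma smoothing_eigenvalues_D_op:
  assumes "h > 0" "c > 0"
  shows "z \<in> smoothing_eigenvalues (D_op h c) \<longleftrightarrow> z = 0 \<or>
    (\<exists>x\<in>{0..1}. \<exists>y\<in>{0..1}. z = of_real (1 - contraction_defect c x y / (1 + 20 * c)\<^sup>2))"
proof -
  define f where "f x y = (of_real (1 - contraction_defect c x y / (1 + 20 * c)\<^sup>2) :: complex)"
    for x y
  have "z \<in> smoothing_eigenvalues (D_op h c) \<longleftrightarrow>
      (\<exists>\<theta>\<in>\<Theta>_low. z = 0 \<or> z = f (cos (fst \<theta>)) (cos (snd \<theta>)))"
    by (simp only: smoothing_eigenvalues_def eigenvalue_D_op[OF assms] f_def mem_Collect_eq)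
  also have "\<dots> \<longleftrightarrow> (\<exists>p\<in>(\<lambda>\<theta>. (cos (fst \<theta>), cos (snd \<theta>))) ` \<Theta>_low. z = 0 \<or> z = f (fst p) (snd p))"
    by simp
  also have "\<dots> \<longleftrightarrow> (\<exists>x\<in>{0..1::real}. \<exists>y\<in>{0..1::real}. z = 0 \<or> z = f x y)"
    unfolding cos_range_\<Theta>_low by simp
  also have "\<dots> \<longleftrightarrow> z = 0 \<or> (\<exists>x\<in>{0..1}. \<exists>y\<in>{0..1}. z = f x y)"
    by (metis atLeastAtMost_iff order_refl zero_le_one)
  finally show ?thesis unfolding f_def .
qed

section \<open>The minimum at the corner\<close>

text \<open>For fixed \<open>s = x + y\<close> the defect is affine and increasing in \<open>w = 2 - x\<^sup>2 - y\<^sup>2\<close>, and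
  \<open>w \<ge> 2 - s\<close> on the unit square. At \<open>w = 2 - s\<close> the excess over the corner value is divisible by
  \<open>2 - s\<close>, and the cofactor, a quadratic in \<open>c\<close> with negative discriminant, becomes nonnegative on
  completing the square.\<close>

lemma contraction_defect_ge:
  assumes "c > 0" and x: "x \<in> {0..1}" and y: "y \<in> {0..1}"
  shows "contraction_defect c 1 1 \<le> contraction_defect c x y"
proof -
  define s w where "s = x + y" and "w = 2 - x\<^sup>2 - y\<^sup>2"
  have s: "0 \<le> s" "s \<le> 2" using x y by (auto simp: s_def)
  have "x\<^sup>2 \<le> x" "y\<^sup>2 \<le> y" using x y by (auto simp: power2_eq_square mult_left_le)
  then have w: "w \<ge> 2 - s" by (simp add: s_def w_def)
  have "s\<^sup>2 \<le> 2 * s" using s by (simp add: power2_eq_square mult_right_mono)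
  then have quad: "0 \<le> 28 + 88 * s - 4 * s\<^sup>2" using s by linarith
  have "c * s \<le> c * 2" using assms(1) s by (intro mult_left_mono) auto
  then have coeff: "0 \<le> 1 + 20 * c - 8 * c * s" using assms(1) unfolding mult.assoc by linarith
  have "contraction_defect c x y - contraction_defect c 1 1 =
      (4 * c * (2 + s)\<^sup>2 + w) * (1 + 20 * c - 8 * c * s) - 64 * c * (1 + 4 * c)"
    by (simp add: contraction_defect_def s_def w_def power2_eq_square algebra_simps)
  also have "\<dots> = (w - (2 - s)) * (1 + 20 * c - 8 * c * s)
      + (2 - s) * ((1 - c * (2 + 6 * s))\<^sup>2 + c\<^sup>2 * (28 + 88 * s - 4 * s\<^sup>2))"
    by (simp add: power2_eq_square algebra_simps)
  also have "\<dots> \<ge> 0"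
    using w s quad coeff by (intro add_nonneg_nonneg mult_nonneg_nonneg) auto
  finally show ?thesis by simp
qed

section \<open>The maximum on the diagonal\<close>

lemma contraction_defect_le_diagonal:
  assumes "c > 0" and x: "x \<in> {0..1}" and y: "y \<in> {0..1}"
  shows "contraction_defect c x y \<le> contraction_defect c ((x + y) / 2) ((x + y) / 2)"
proof -
  have "c * (x + y) \<le> c * 2" using assms by (intro mult_left_mono) auto
  then have coeff: "0 \<le> 1 + 20 * c - 8 * c * (x + y)" using assms(1) unfolding mult.assoc by linarith
  have "contraction_defect c ((x + y) / 2) ((x + y) / 2) - contraction_defect c x y =
      (x - y)\<^sup>2 / 2 * (1 + 20 * c - 8 * c * (x + y))"
    by (simp add: contraction_defect_def power2_eq_square field_simps)
  also have "\<dots> \<ge> 0" using coeff by simp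
  finally show ?thesis by simp
qed

text \<open>The critical points of the defect along the diagonal are the roots of
  \<open>12 c (8 c - 1) s\<^sup>2 + crit_linear c s - 192 c\<^sup>2\<close>, and \<open>crit_discr\<close> is its discriminant.\<close>

definition crit_discr :: "real \<Rightarrow> real" where
  "crit_discr c = 82944 * c^4 - 6912 * c^3 + 336 * c^2 + 24 * c + 1"

definition crit_linear :: "real \<Rightarrow> real" where
  "crit_linear c = 96 * c\<^sup>2 + 12 * c + 1"

text \<open>The root in \<open>[0, 2]\<close>, with the square root moved to the denominator so that the formula stays
  valid for \<open>c = 1/8\<close>, where the quadratic degenerates to a linear polynomial.\<close>

definition argmax_sum :: "real \<Rightarrow> real" where
  "argmax_sum c = 384 * c\<^sup>2 / (crit_linear c + sqrt (crit_discr c))"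

lemma crit_discr_eq: "crit_discr c = (crit_linear c)\<^sup>2 + 9216 * c ^ 3 * (8 * c - 1)"
  by (simp add: crit_discr_def crit_linear_def power2_eq_square power3_eq_cube power4_eq_xxxx
      algebra_simps)

lemma crit_discr_nonneg: "0 \<le> crit_discr c"
proof -
  have "crit_discr c = (1 + 12 * c)\<^sup>2 + 48 * c\<^sup>2 * (3 * (1 - 24 * c)\<^sup>2 + 1)"
    by (simp add: crit_discr_def power2_eq_square power3_eq_cube power4_eq_xxxx algebra_simps)
  then show ?thesis by simp
qed

lemma crit_linear_pos: "c > 0 \<Longrightarrow> crit_linear c > 0"
  by (simp add: crit_linear_def add_pos_pos)

lemma argmax_sum_range:
  assumes "c > 0"
  shows "argmax_sum c \<in> {0..2}"
proof -
  have "crit_discr c - (96 * c\<^sup>2 - 12 * c - 1)\<^sup>2 = 384 * c\<^sup>2 * (3 * (8 * c)\<^sup>2 - 12 * c + 1)"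
    by (simp add: crit_discr_def power2_eq_square power3_eq_cube power4_eq_xxxx algebra_simps)
  also have "3 * (8 * c)\<^sup>2 - 12 * c + 1 = (8 * c - 3/4)\<^sup>2 + 2 * (8 * c)\<^sup>2 + 7/16"
    by (simp add: power2_eq_square algebra_simps)
  also have "384 * c\<^sup>2 * \<dots> \<ge> 0" by simp
  finally have "96 * c\<^sup>2 - 12 * c - 1 \<le> sqrt (crit_discr c)"
    by (intro real_le_rsqrt) simp
  then have "384 * c\<^sup>2 \<le> 2 * (crit_linear c + sqrt (crit_discr c))"
    by (simp add: crit_linear_def)
  moreover have "crit_linear c + sqrt (crit_discr c) > 0"
    using crit_linear_pos[OF assms] crit_discr_nonneg[of c] by (simp add: add_pos_nonneg)
  ultimately show ?thesis
    by (simp add: argmax_sum_def divide_le_eq)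
qed

lemma argmax_sum_eq:
  assumes "c > 0"
  shows "24 * c * (8 * c - 1) * argmax_sum c = sqrt (crit_discr c) - crit_linear c"
proof -
  have pos: "crit_linear c + sqrt (crit_discr c) > 0"
    using crit_linear_pos[OF assms] crit_discr_nonneg[of c] by (simp add: add_pos_nonneg)
  have "(sqrt (crit_discr c) - crit_linear c) * (crit_linear c + sqrt (crit_discr c)) = (sqrt (crit_discr c))\<^sup>2 - (crit_linear c)\<^sup>2"
    by (simp add: power2_eq_square algebra_simps)
  also have "\<dots> = 24 * c * (8 * c - 1) * (384 * c\<^sup>2)"
    using crit_discr_nonneg[of c] by (simp add: crit_discr_eq power2_eq_square power3_eq_cube algebra_simps)
  finally show ?thesis
    using pos by (simp add: argmax_sum_def field_simps)
qed

lemma argmax_sum_critical: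
  assumes "c > 0"
  shows "12 * c * (8 * c - 1) * (argmax_sum c)\<^sup>2 + crit_linear c * argmax_sum c = 192 * c\<^sup>2"
proof -
  define \<sigma> where "\<sigma> = argmax_sum c"
  have pos: "crit_linear c + sqrt (crit_discr c) > 0"
    using crit_linear_pos[OF assms] crit_discr_nonneg[of c] by (simp add: add_pos_nonneg)
  have "12 * c * (8 * c - 1) * \<sigma>\<^sup>2 + crit_linear c * \<sigma> = (24 * c * (8 * c - 1) * \<sigma> / 2 + crit_linear c) * \<sigma>"
    by (simp add: power2_eq_square field_simps)
  also have "\<dots> = (crit_linear c + sqrt (crit_discr c)) / 2 * \<sigma>"
    unfolding \<sigma>_def argmax_sum_eq[OF assms] by (simp add: field_simps)
  also have "\<dots> = 192 * c\<^sup>2"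
    using pos by (simp add: \<sigma>_def argmax_sum_def)
  finally show ?thesis by (simp add: \<sigma>_def)
qed

definition max_defect :: "real \<Rightarrow> real" where
  "max_defect c = contraction_defect c (argmax_sum c / 2) (argmax_sum c / 2)"

lemma contraction_defect_diagonal:
  "contraction_defect c (s / 2) (s / 2) =
     2 * (8 * c + 1) * (20 * c + 1) + 192 * c\<^sup>2 * s - crit_linear c / 2 * s\<^sup>2 - 4 * c * (8 * c - 1) * s ^ 3"
  by (simp add: contraction_defect_def crit_linear_def power2_eq_square power3_eq_cube field_simps)

text \<open>The difference of a cubic to its value at a critical point \<open>\<sigma>\<close> is \<open>(s - \<sigma>)\<^sup>2\<close> times a linear
  polynomial in \<open>s\<close>; the closed form of \<open>\<sigma>\<close> shows that polynomial to be nonnegative on \<open>[0, 2]\<close>.\<close>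

lemma contraction_defect_diagonal_le:
  assumes "c > 0" and s: "s \<in> {0..2}"
  shows "contraction_defect c (s / 2) (s / 2) \<le> max_defect c"
proof -
  define \<sigma> a where "\<sigma> = argmax_sum c" and "a = c * (8 * c - 1)"
  have crit: "192 * c\<^sup>2 = 12 * a * \<sigma>\<^sup>2 + crit_linear c * \<sigma>"
    using argmax_sum_critical[OF assms(1)] by (simp add: \<sigma>_def a_def algebra_simps)
  have "max_defect c - contraction_defect c (s / 2) (s / 2) =
      (12 * a * \<sigma>\<^sup>2 + crit_linear c * \<sigma>) * (\<sigma> - s)
        - crit_linear c / 2 * (\<sigma>\<^sup>2 - s\<^sup>2) - 4 * a * (\<sigma> ^ 3 - s ^ 3)"
    unfolding max_defect_def contraction_defect_diagonal \<sigma>_def[symmetric] crit[symmetric]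
    by (simp add: a_def algebra_simps)
  also have "\<dots> = (s - \<sigma>)\<^sup>2 * (crit_linear c / 2 + 8 * a * \<sigma> + 4 * a * s)"
    by (simp add: power2_eq_square power3_eq_cube algebra_simps)
  also have "8 * a * \<sigma> = (sqrt (crit_discr c) - crit_linear c) / 3"
    using argmax_sum_eq[OF assms(1)] by (simp add: \<sigma>_def a_def algebra_simps)
  also have "(s - \<sigma>)\<^sup>2 * (crit_linear c / 2 + (sqrt (crit_discr c) - crit_linear c) / 3 + 4 * a * s) \<ge> 0"
  proof -
    have "0 \<le> crit_linear c / 6 + 4 * a * s"
    proof (cases "a \<ge> 0")
      case True
      then show ?thesis using crit_linear_pos[OF assms(1)] s by (intro add_nonneg_nonneg) auto
    next
      case False
      \<comment> \<open>For \<open>a < 0\<close> the left-hand side decreases in \<open>s\<close>, and at \<open>s = 2\<close> it is a positive quadratic in \<open>c\<close>.\<close>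
      have "0 \<le> 5 * (4 * c - 3/20)\<^sup>2 + 13/240" by simp
      also have "\<dots> = crit_linear c / 6 + 4 * a * 2"
        by (simp add: crit_linear_def a_def power2_eq_square field_simps)
      also have "4 * a * 2 \<le> 4 * a * s" using False s by (intro mult_left_mono_neg) auto
      finally show ?thesis by simp
    qed
    then have "0 \<le> crit_linear c / 2 + (sqrt (crit_discr c) - crit_linear c) / 3 + 4 * a * s"
      using real_sqrt_ge_zero[OF crit_discr_nonneg[of c]] by argo
    then show ?thesis by simp
  qed
  finally show ?thesis by simp
qed

text \<open>The midpoint \<open>x = y = 1/2\<close> is a witness for every \<open>c\<close>. This bound makes the least eigenvalue
  nonpositive, so that the trivial eigenvalue \<open>0\<close> does not undercut it.\<close>

lemma max_defect_lower:
  assumes "c > 0"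
  shows "(1 + 20 * c)\<^sup>2 \<le> max_defect c"
proof -
  have "(1 + 20 * c)\<^sup>2 \<le> contraction_defect c (1 / 2) (1 / 2)"
    using assms by (simp add: contraction_defect_def power2_eq_square field_simps)
  also have "\<dots> \<le> max_defect c" by (rule contraction_defect_diagonal_le) (use assms in auto)
  finally show ?thesis .
qed

text \<open>This keeps the least eigenvalue above \<open>-1\<close>. As a polynomial in \<open>c\<close> the difference of the two sides
  has nonnegative coefficients for each \<open>s\<close> in \<open>[0, 2]\<close>.\<close>

lemma max_defect_upper:
  assumes "c > 0"
  shows "max_defect c < 2 * (1 + 20 * c)\<^sup>2"
proof -
  define s where "s = argmax_sum c"
  have s: "0 \<le> s" "s \<le> 2" using argmax_sum_range[OF assms] by (auto simp: s_def)
  have cube: "s ^ 3 \<le> 2 * s\<^sup>2"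
    using mult_right_mono[of s 2 "s\<^sup>2"] s by (simp add: power3_eq_cube power2_eq_square)
  have square: "s\<^sup>2 \<le> 2 * s" using s by (simp add: power2_eq_square mult_right_mono)
  have "0 \<le> s\<^sup>2" "0 \<le> s ^ 3" using s by simp_all
  then have pos: "0 < 480 - 192 * s + 48 * s\<^sup>2 + 32 * s ^ 3" "0 \<le> 24 + 6 * s\<^sup>2 - 4 * s ^ 3"
    using s cube square by linarith+
  have "2 * (1 + 20 * c)\<^sup>2 - max_defect c =
     c\<^sup>2 * (480 - 192 * s + 48 * s\<^sup>2 + 32 * s ^ 3) + c * (24 + 6 * s\<^sup>2 - 4 * s ^ 3) + s\<^sup>2 / 2"
    unfolding max_defect_def contraction_defect_diagonal s_def[symmetric]
    by (simp add: crit_linear_def power2_eq_square field_simps)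
  also have "\<dots> > 0"
    using mult_pos_pos[OF _ pos(1), of "c\<^sup>2"] mult_nonneg_nonneg[OF _ pos(2), of c] assms
    by (intro add_pos_nonneg[OF add_pos_nonneg]) auto
  finally show ?thesis by simp
qed

section \<open>The closed forms\<close>

text \<open>The cubic is evaluated through \<open>u = 24 a \<sigma> = sqrt R - K\<close>, where \<open>a = c (8 c - 1)\<close>,
  \<open>K = crit_linear c\<close> and \<open>\<sigma>\<close> is the maximizer: the factor \<open>1728 a\<^sup>2\<close> is what makes all
  coefficients polynomial when the powers of \<open>\<sigma>\<close> are written in \<open>u\<close>. Eliminating \<open>a c\<^sup>2\<close> by
  \<open>R = K\<^sup>2 + 9216 a c\<^sup>2\<close> cancels the terms in \<open>K\<^sup>2 sqrt R\<close>, which leaves \<open>R sqrt R\<close> as the only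
  irrational term.\<close>

lemma max_defect_closed_form:
  assumes "c > 0"
  shows "1728 * (1 - 8 * c)\<^sup>2 * c\<^sup>2 * (contraction_defect c 1 1 + max_defect c) =
    -1 - 36 * c + 2736 * c^2 + 157248 * c^3 - 2115072 * c^4 - 2985984 * c^5
      + 52199424 * c^6 + crit_discr c * sqrt (crit_discr c)"
proof -
  define a u \<sigma> r where "a = c * (8 * c - 1)" and "u = sqrt (crit_discr c) - crit_linear c"
    and "\<sigma> = argmax_sum c" and "r = sqrt (crit_discr c)"
  have u: "24 * a * \<sigma> = u"
    using argmax_sum_eq[OF assms] by (simp add: a_def \<sigma>_def u_def algebra_simps)
  have r2: "r * r = crit_discr c" using crit_discr_nonneg[of c] by (simp add: r_def)
  have a2: "(1 - 8 * c)\<^sup>2 * c\<^sup>2 = a\<^sup>2" by (simp add: a_def power2_eq_square algebra_simps)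
  have "1728 * (1 - 8 * c)\<^sup>2 * c\<^sup>2 * max_defect c = 1728 * a\<^sup>2 * max_defect c"
    unfolding a2[symmetric] by (simp only: mult.assoc)
  also have "\<dots> = 3456 * a\<^sup>2 * (8 * c + 1) * (20 * c + 1) + 13824 * a * c\<^sup>2 * (24 * a * \<sigma>)
      - 3/2 * crit_linear c * (24 * a * \<sigma>)\<^sup>2 - (24 * a * \<sigma>) ^ 3 / 2"
    unfolding max_defect_def contraction_defect_diagonal \<sigma>_def[symmetric]
    by (simp add: a_def[symmetric] mult.assoc[symmetric])
      (simp add: power2_eq_square power3_eq_cube field_simps a_def)
  also have "\<dots> = 3456 * a\<^sup>2 * (8 * c + 1) * (20 * c + 1) + 3/2 * (9216 * a * c\<^sup>2) * (r - crit_linear c)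
      - (r * r * r - 3 * crit_linear c ^ 2 * r + 2 * crit_linear c ^ 3) / 2"
    unfolding u by (simp add: u_def r_def[symmetric] power2_eq_square power3_eq_cube field_simps)
  also have "9216 * a * c\<^sup>2 = r * r - (crit_linear c)\<^sup>2"
    unfolding r2 crit_discr_eq by (simp add: a_def power2_eq_square power3_eq_cube algebra_simps)
  also have "3456 * a\<^sup>2 * (8 * c + 1) * (20 * c + 1) + 3/2 * (r * r - (crit_linear c)\<^sup>2) * (r - crit_linear c)
      - (r * r * r - 3 * crit_linear c ^ 2 * r + 2 * crit_linear c ^ 3) / 2 =
      3456 * a\<^sup>2 * (8 * c + 1) * (20 * c + 1) + (r * r) * r - 3/2 * crit_linear c * (r * r) + crit_linear c ^ 3 / 2"
    by (simp add: power2_eq_square power3_eq_cube field_simps)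
  finally show ?thesis
    unfolding r2 distrib_left r_def[symmetric]
    by (simp add: contraction_defect_def a_def crit_linear_def crit_discr_def)
      (simp add: field_simps eval_nat_numeral)
qed

text \<open>Here \<open>(1 + 20 c)\<^sup>2\<close> exceeds the corner value by the square \<open>(1 - 12 c)\<^sup>2\<close>, so the corner
  eigenvalue is nonnegative and dominates the trivial eigenvalue \<open>0\<close>.\<close>

lemma is_maximum_D_op:
  assumes "h > 0" "c > 0"
  shows "is_maximum (smoothing_eigenvalues (D_op h c))
    (1 - contraction_defect c 1 1 / (1 + 20 * c)\<^sup>2)"
proof -
  have "contraction_defect c 1 1 \<le> (1 + 20 * c)\<^sup>2"
  proof -
    have "(1 + 20 * c)\<^sup>2 - contraction_defect c 1 1 = (1 - 12 * c)\<^sup>2"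
      by (simp add: contraction_defect_def power2_eq_square algebra_simps)
    then show ?thesis by (metis diff_ge_0_iff_ge zero_le_power2)
  qed
  then have "0 \<le> 1 - contraction_defect c 1 1 / (1 + 20 * c)\<^sup>2"
    using assms by (simp add: divide_le_eq)
  moreover have "1 - contraction_defect c x y / (1 + 20 * c)\<^sup>2
      \<le> 1 - contraction_defect c 1 1 / (1 + 20 * c)\<^sup>2" if "x \<in> {0..1}" "y \<in> {0..1}" for x y
    using contraction_defect_ge[OF assms(2) that] by (simp add: divide_right_mono)
  ultimately show ?thesis
    unfolding is_maximum_def Ball_def smoothing_eigenvalues_D_op[OF assms]
    by (auto simp del: of_real_diff of_real_divide intro!: bexI[of _ 1])
qed

lemma is_minimum_D_op:
  assumes "h > 0" "c > 0"
  shows "is_minimum (smoothing_eigenvalues (D_op h c)) (1 - max_defect c / (1 + 20 * c)\<^sup>2)"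
proof -
  have "1 - max_defect c / (1 + 20 * c)\<^sup>2 \<le> 0"
    using max_defect_lower[OF assms(2)] assms by (simp add: le_divide_eq)
  moreover have "1 - max_defect c / (1 + 20 * c)\<^sup>2 \<le> 1 - contraction_defect c x y / (1 + 20 * c)\<^sup>2"
    if xy: "x \<in> {0..1}" "y \<in> {0..1}" for x y
  proof -
    have "contraction_defect c x y \<le> max_defect c"
      using contraction_defect_le_diagonal[OF assms(2) xy]
        contraction_defect_diagonal_le[OF assms(2), of "x + y"] xy by auto
    then show ?thesis by (simp add: divide_right_mono)
  qed
  moreover have "argmax_sum c / 2 \<in> {0..1}" using argmax_sum_range[OF assms(2)] by auto
  ultimately show ?thesis
    unfolding is_minimum_def Ball_def smoothing_eigenvalues_D_op[OF assms] max_defect_def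
    by (auto simp del: of_real_diff of_real_divide intro!: bexI[of _ "argmax_sum c / 2"])
qed

theorem theorem4:
  fixes h c :: real
  assumes "h > 0" and "c > 0"
  shows "(\<exists>s. is_maximum (smoothing_eigenvalues (D_op h c)) s) \<and>
    (\<exists>s. is_minimum (smoothing_eigenvalues (D_op h c)) s) \<and>
    S_max (D_op h c) \<in> {-1 <..< 1} \<and>
    S_min (D_op h c) \<in> {-1 <..< 1} \<and>
    (c \<noteq> 1/8 \<longrightarrow>
      (let R = 82944 * c^4 - 6912 * c^3 + 336 * c^2 + 24 * c + 1;
           N = -1 - 36 * c + 2736 * c^2 + 157248 * c^3 - 2115072 * c^4 - 2985984 * c^5
               + 52199424 * c^6 + R * sqrt R
       in omega_opt (D_op h c) = 3456 * (1 - 8 * c)^2 * c^2 * (20 * c + 1)^2 / N \<and>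
          rho_opt (D_op h c) =
            (-1 - 36 * c + 2736 * c^2 - 63936 * c^3 + 539136 * c^4 - 2985984 * c^5
             - 4423680 * c^6 + R * sqrt R) / N)) \<and>
    (c = 1/8 \<longrightarrow> omega_opt (D_op h c) = 196/217 \<and> rho_opt (D_op h c) = 25/217)"
proof -
  define L m M where "L = (1 + 20 * c)\<^sup>2" and "m = contraction_defect c 1 1" and "M = max_defect c"
  have max: "is_maximum (smoothing_eigenvalues (D_op h c)) (1 - m / L)"
    using is_maximum_D_op[OF assms] by (simp add: L_def m_def)
  have min: "is_minimum (smoothing_eigenvalues (D_op h c)) (1 - M / L)"
    using is_minimum_D_op[OF assms] by (simp add: L_def M_def)
  have Smax: "S_max (D_op h c) = 1 - m / L"
    unfolding S_max_def using max by (blast intro: is_maximum_unique)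
  have Smin: "S_min (D_op h c) = 1 - M / L"
    unfolding S_min_def using min by (blast intro: is_minimum_unique)
  have L: "L > 0" using assms by (simp add: L_def)
  have m: "m = 64 * c * (1 + 4 * c)"
    by (simp add: m_def contraction_defect_def power2_eq_square algebra_simps)
  have m0: "0 < m" using assms by (simp add: m add_pos_pos)
  have mL: "m < 2 * L" using assms by (simp add: m L_def power2_eq_square algebra_simps add_pos_pos)
  have M: "0 < M" "M < 2 * L"
    using max_defect_upper[OF assms(2)] max_defect_lower[OF assms(2)] L by (auto simp: L_def M_def)
  have omega: "omega_opt (D_op h c) = 2 * L / (m + M)"
  proof -
    have "2 - (1 - m / L) - (1 - M / L) = (m + M) / L" by (simp add: add_divide_distrib)
    then show ?thesis unfolding omega_opt_def Smax Smin by simp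
  qed
  have rho: "rho_opt (D_op h c) = (M - m) / (m + M)"
  proof -
    have "2 - (1 - m / L) - (1 - M / L) = (m + M) / L" "1 - m / L - (1 - M / L) = (M - m) / L"
      by (simp_all add: add_divide_distrib diff_divide_distrib)
    then show ?thesis unfolding rho_opt_def Smax Smin using L by simp
  qed
  define N where "N = -1 - 36 * c + 2736 * c^2 + 157248 * c^3 - 2115072 * c^4 - 2985984 * c^5
      + 52199424 * c^6 + crit_discr c * sqrt (crit_discr c)"
  define k where "k = 1728 * (1 - 8 * c)\<^sup>2 * c\<^sup>2"
  have N: "k * (m + M) = N"
    using max_defect_closed_form[OF assms(2)] by (simp add: N_def k_def m_def M_def)
  \<comment> \<open>Both quotients are expanded by \<open>k\<close>, which is nonzero precisely because \<open>c \<noteq> 1/8\<close>.\<close>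
  have generic: "omega_opt (D_op h c) = 3456 * (1 - 8 * c)^2 * c^2 * (20 * c + 1)^2 / N \<and>
      rho_opt (D_op h c) = (-1 - 36 * c + 2736 * c^2 - 63936 * c^3 + 539136 * c^4 - 2985984 * c^5
             - 4423680 * c^6 + crit_discr c * sqrt (crit_discr c)) / N" if "c \<noteq> 1/8"
  proof -
    have k: "k \<noteq> 0" using that assms by (simp add: k_def)
    have "omega_opt (D_op h c) = k * (2 * L) / N"
      unfolding omega N[symmetric] using k by simp
    moreover have "k * (2 * L) = 3456 * (1 - 8 * c)^2 * c^2 * (20 * c + 1)^2"
      by (simp add: k_def L_def add.commute)
    moreover have "rho_opt (D_op h c) = k * (M - m) / N"
      unfolding rho N[symmetric] using k by simp
    moreover have "k * (M - m) = N - 2 * k * m"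
      unfolding N[symmetric] by (simp add: algebra_simps)
    moreover have "N - 2 * k * m = -1 - 36 * c + 2736 * c^2 - 63936 * c^3 + 539136 * c^4
        - 2985984 * c^5 - 4423680 * c^6 + crit_discr c * sqrt (crit_discr c)"
      unfolding N_def k_def m by (simp add: eval_nat_numeral algebra_simps)
    ultimately show ?thesis by simp
  qed
  have special: "omega_opt (D_op h c) = 196/217 \<and> rho_opt (D_op h c) = 25/217" if c: "c = 1/8"
  proof -
    have R: "crit_discr c = 4\<^sup>2" by (simp add: c crit_discr_def power_divide)
    have "sqrt (crit_discr c) = 4" unfolding R by (rule real_sqrt_unique) auto
    then have argmax: "argmax_sum c = 3/4"
      unfolding argmax_sum_def crit_linear_def by (simp add: c power_divide)
    have M: "M = 121/8"
      unfolding M_def max_defect_def argmax by (simp add: contraction_defect_def c power2_eq_square)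
    then show ?thesis
      unfolding omega rho M by (simp add: m L_def c power2_eq_square)
  qed
  have "S_max (D_op h c) \<in> {-1<..<1}" "S_min (D_op h c) \<in> {-1<..<1}"
    unfolding Smax Smin using L m0 mL M by (auto simp: field_simps)
  then show ?thesis
    using max min generic special unfolding Let_def crit_discr_def N_def by blast
qed

end
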